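(* Let $N\ge392$ be an integer and $r>0$. For $k\in\mathbb{Z}^2_{0,N}$ let $H^k$ be the real matrix indexed by $\mathbb{Z}^2_{0,N}$ with entries $(H^k)_{\ell,j}=c_{j,k}\delta_{k+j=\ell}$, and let $\mathfrak{h}=\mathrm{span}\{[H^k,H^{-k}]:k\in\mathbb{Z}^2_{0,N}\}$, which consists of diagonal matrices. If $\mathfrak{h}$ contains a distinct matrix, then $\mathrm{Lie}(\{H^k:k\in\mathbb{Z}^2_{0,N}\})=\mathfrak{sl}_{\mathbb{Z}^2_{0,N}}(\mathbb{R})$.
   Context: $\mathbb{Z}^2_{0,N}=\{k\in\mathbb{Z}^2\setminus\{0\}:\max(|k_1|,|k_2|)\le N\}$; $|k|_r^2=k_1^2+r^2k_2^2$, $\langle j^\perp,k\rangle_r=r(j_2k_1-j_1k_2)$, and $c_{j,k}=\langle j^\perp,k\rangle_r\big(|k|_r^{-2}-|j|_r^{-2}\big)$ for $j,k\in\mathbb{Z}^2\setminus\{0\}$. $\mathfrak{sl}_{\mathbb{Z}^2_{0,N}}(\mathbb{R})$ is the Lie algebra of real trace-free matrices indexed by $\mathbb{Z}^2_{0,N}$; $\mathrm{Lie}(\cdot)$ denotes the generated real Lie algebra under the commutator. Let $\mathcal{C}_N=\{(i,j,\ell,m)\in(\mathbb{Z}^2_{0,N})^4:(i+j,\ell+m)\ne(0,0),\ (i+\ell,j+m)\ne(0,0),\ (i+m,j+\ell)\neq(0,0)\}$. A diagonal matrix $\mathbb{D}\in\mathfrak{h}$ with diagonal entries $\mathbb{D}_i=\mathbb{D}_{ii}$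 is distinct if $\mathbb{D}_i+\mathbb{D}_j+\mathbb{D}_\ell+\mathbb{D}_m\ne0$ for every $(i,j,\ell,m)\in\mathcal{C}_N$ with $i+j+\ell+m=0$. *)

theory Defs
  imports Complex_Main "HOL-Library.Product_Plus" "HOL-Library.Function_Algebras"
begin

definition Z20 :: "int \<Rightarrow> (int \<times> int) set" where
  "Z20 N = {k. k \<noteq> 0 \<and> max \<bar>fst k\<bar> \<bar>snd k\<bar> \<le> N}"

definition normsq :: "real \<Rightarrow> int \<times> int \<Rightarrow> real" where
  "normsq r k = (of_int (fst k))\<^sup>2 + r\<^sup>2 * (of_int (snd k))\<^sup>2"

text \<open>\<open>perp_inner r j k\<close> is \<open>\<langle>j\<^sup>\<bottom>, k\<rangle>\<close> for the \<open>r\<close>-weighted inner product; the first argument is the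
  vector that gets rotated.\<close>

definition perp_inner :: "real \<Rightarrow> int \<times> int \<Rightarrow> int \<times> int \<Rightarrow> real" where
  "perp_inner r j k = r * of_int (snd j * fst k - fst j * snd k)"

definition coef :: "real \<Rightarrow> int \<times> int \<Rightarrow> int \<times> int \<Rightarrow> real" where
  "coef r j k = perp_inner r j k * (inverse (normsq r k) - inverse (normsq r j))"

text \<open>A matrix indexed by \<open>Z20 N\<close> is a function on all pairs of indices that vanishes off
  \<open>Z20 N \<times> Z20 N\<close>, so that equality of such matrices is equality of functions. The first argument
  is the row. Addition, subtraction and zero are the pointwise ones; the pointwise product on
  functions is not the matrix product, which is \<open>mmult\<close>.\<close>

type_synonym matrix = "int \<times> int \<Rightarrow> int \<times> int \<Rightarrow> real"

definition gl :: "int \<Rightarrow> matrix set" where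
  "gl N = {A. \<forall>i j. i \<notin> Z20 N \<or> j \<notin> Z20 N \<longrightarrow> A i j = 0}"

definition mscale :: "real \<Rightarrow> matrix \<Rightarrow> matrix" where
  "mscale a A = (\<lambda>i j. a * A i j)"

definition mmult :: "int \<Rightarrow> matrix \<Rightarrow> matrix \<Rightarrow> matrix" where
  "mmult N A B = (\<lambda>i j. \<Sum>m\<in>Z20 N. A i m * B m j)"

definition commutator :: "int \<Rightarrow> matrix \<Rightarrow> matrix \<Rightarrow> matrix" where
  "commutator N A B = mmult N A B - mmult N B A"

definition sl :: "int \<Rightarrow> matrix set" where
  "sl N = {A \<in> gl N. (\<Sum>i\<in>Z20 N. A i i) = 0}"

interpretation matrix: vector_space mscale
  by unfold_locales (auto simp: mscale_def fun_eq_iff algebra_simps)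

definition lie_subalgebra :: "int \<Rightarrow> matrix set \<Rightarrow> bool" where
  "lie_subalgebra N L \<longleftrightarrow>
     L \<subseteq> gl N \<and> matrix.subspace L \<and> (\<forall>A\<in>L. \<forall>B\<in>L. commutator N A B \<in> L)"

definition Lie :: "int \<Rightarrow> matrix set \<Rightarrow> matrix set" where
  "Lie N S = lie_subalgebra N hull S"

definition H :: "int \<Rightarrow> real \<Rightarrow> int \<times> int \<Rightarrow> matrix" where
  "H N r k = (\<lambda>l j. if l \<in> Z20 N \<and> j \<in> Z20 N \<and> k + j = l then coef r j k else 0)"

definition diag_space :: "int \<Rightarrow> real \<Rightarrow> matrix set" where
  "diag_space N r = matrix.span ((\<lambda>k. commutator N (H N r k) (H N r (- k))) ` Z20 N)"

definition diagonal :: "matrix \<Rightarrow> bool" where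
  "diagonal A \<longleftrightarrow> (\<forall>i j. i \<noteq> j \<longrightarrow> A i j = 0)"

definition quads :: "int \<Rightarrow> ((int \<times> int) \<times> (int \<times> int) \<times> (int \<times> int) \<times> (int \<times> int)) set" where
  "quads N = {(i, j, l, m). i \<in> Z20 N \<and> j \<in> Z20 N \<and> l \<in> Z20 N \<and> m \<in> Z20 N \<and>
     (i + j, l + m) \<noteq> (0, 0) \<and> (i + l, j + m) \<noteq> (0, 0) \<and> (i + m, j + l) \<noteq> (0, 0)}"

definition distinct_matrix :: "int \<Rightarrow> matrix \<Rightarrow> bool" where
  "distinct_matrix N D \<longleftrightarrow> diagonal D \<and>
     (\<forall>(i, j, l, m) \<in> quads N. i + j + l + m = 0 \<longrightarrow> D i i + D j j + D l l + D m m \<noteq> 0)"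

lemma H_in_gl: "H N r k \<in> gl N"
  by (auto simp: gl_def H_def)

lemma lie_subalgebra_gl: "lie_subalgebra N (gl N)"
proof -
  have zero: "A i j = 0" if "A \<in> gl N" "i \<notin> Z20 N \<or> j \<notin> Z20 N" for A i j
    using that unfolding gl_def by blast
  have sub: "A - B \<in> gl N" if "A \<in> gl N" "B \<in> gl N" for A B
    using that by (simp add: gl_def)
  have "mmult N A B \<in> gl N" if A: "A \<in> gl N" and B: "B \<in> gl N" for A B
  proof -
    have "mmult N A B i j = 0" if "i \<notin> Z20 N \<or> j \<notin> Z20 N" for i j
      unfolding mmult_def using that zero[OF A, of i] zero[OF B, of _ j]
      by (intro sum.neutral) (metis mult_eq_0_iff)
    then show ?thesis unfolding gl_def by blast
  qed
  then have "commutator N A B \<in> gl N" if "A \<in> gl N" "B \<in> gl N" for A B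
    using that by (simp add: commutator_def sub)
  moreover have "matrix.subspace (gl N)"
    by (auto simp: matrix.subspace_def gl_def mscale_def)
  ultimately show ?thesis by (simp add: lie_subalgebra_def)
qed

lemma diag_space_diagonal:
  assumes "D \<in> diag_space N r"
  shows "diagonal D"
proof -
  have prod: "mmult N (H N r k) (H N r (- k)) i j = 0" if "i \<noteq> j" for k i j
    unfolding mmult_def using that by (intro sum.neutral) (auto simp: H_def)
  have "diagonal (commutator N (H N r k) (H N r (- k)))" for k
    using prod[of _ _ k] prod[of _ _ "- k"] by (simp add: diagonal_def commutator_def)
  moreover have "matrix.subspace (Collect diagonal)"
    by (auto simp: matrix.subspace_def diagonal_def mscale_def)
  ultimately have "diag_space N r \<subseteq> Collect diagonal"
    unfolding diag_space_def by (intro matrix.span_minimal) auto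
  then show ?thesis using assms by auto
qed

end

theory Submission
  imports Defs
begin

text \<open>Write \<open>E\<^sub>a\<^sub>b\<close> for the matrix units and \<open>L\<close> for the generated Lie algebra. That \<open>L\<close> consists of
  trace-free matrices is clear; the point is that \<open>L\<close> contains every \<open>E\<^sub>a\<^sub>b\<close> with \<open>a \<noteq> b\<close>.

  The distinct matrix \<open>D\<close> lies in \<open>L\<close>, so \<open>L\<close> contains the eigencomponents of each \<open>H\<^sup>k\<close> under
  \<open>ad D\<close> (\<open>weight_component_in_L\<close>). The diagonal of \<open>D\<close> is an odd function of the index, which
  forces \<open>E\<^sub>a\<^sub>b\<close> and its mirror image, the unit at row \<open>-b\<close> and column \<open>-a\<close>, to have the same
  weight; distinctness says that within one \<open>H\<^sup>k\<close> there are no other coincidences. The components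
  are therefore the two-term matrices called \<open>twin\<close> below (\<open>twin_in_L\<close>).

  To break a twin apart, two different elements of \<open>L\<close> supported on the same mirror pair are
  needed: the twin of \<open>a, c\<close> itself, and the commutator of the twins of \<open>a, b\<close> and \<open>b, c\<close>. They are
  independent unless a certain determinant vanishes (\<open>separation\<close>), and for \<open>a = (2, -1)\<close>,
  \<open>b = (1, 0)\<close>, \<open>c = (0, 1)\<close> it is positive for every \<open>r > 0\<close> (\<open>separated_link\<close>).

  One isolated matrix unit suffices. Bracketing \<open>E\<^sub>a\<^sub>c\<close> with a twin replaces \<open>a\<close> or \<open>c\<close> by another
  index joined to it by an edge, an edge being a pair whose twin has two nonzero terms
  (\<open>linked_step_left\<close>, \<open>linked_step_right\<close>). Since every index has an edge to one of the four unit
  vectors \<open>(\<plusminus>1, 0)\<close>, \<open>(0, \<plusminus>1)\<close> (\<open>edge_to_axis\<close>), all the matrix units are reached.\<close>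

section \<open>Matrix units and the special linear Lie algebra\<close>

definition unit_matrix :: "int \<times> int \<Rightarrow> int \<times> int \<Rightarrow> matrix" where
  "unit_matrix a b = (\<lambda>i j. if i = a \<and> j = b then 1 else 0)"

lemma finite_Z20 [simp]: "finite (Z20 N)"
proof (rule finite_subset)
  show "Z20 N \<subseteq> {-N..N} \<times> {-N..N}"
    by (auto simp: Z20_def)
qed simp

lemma uminus_in_Z20_iff [simp]: "- k \<in> Z20 N \<longleftrightarrow> k \<in> Z20 N"
  by (auto simp: Z20_def)

lemma Pair_in_Z20_iff: "(x, y) \<in> Z20 N \<longleftrightarrow> (x \<noteq> 0 \<or> y \<noteq> 0) \<and> \<bar>x\<bar> \<le> N \<and> \<bar>y\<bar> \<le> N"
  by (auto simp: Z20_def zero_prod_def)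

lemma mmult_unit_matrix:
  assumes "b \<in> Z20 N"
  shows "mmult N (unit_matrix a b) (unit_matrix c d) = (if b = c then unit_matrix a d else 0)"
proof (intro ext)
  fix i j
  have "mmult N (unit_matrix a b) (unit_matrix c d) i j
      = (\<Sum>m\<in>Z20 N. if m = b then (if i = a \<and> b = c \<and> j = d then 1 else 0) else 0)"
    unfolding mmult_def unit_matrix_def by (intro sum.cong) auto
  then show "mmult N (unit_matrix a b) (unit_matrix c d) i j
      = (if b = c then unit_matrix a d else 0) i j"
    using assms by (auto simp: unit_matrix_def)
qed

lemma commutator_unit_matrix:
  assumes "b \<in> Z20 N" "d \<in> Z20 N"
  shows "commutator N (unit_matrix a b) (unit_matrix c d)
    = (if b = c then unit_matrix a d else 0) - (if d = a then unit_matrix c b else 0)"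
  using assms by (simp add: commutator_def mmult_unit_matrix)

lemma commutator_add_left: "commutator N (A + B) C = commutator N A C + commutator N B C"
  by (simp add: commutator_def mmult_def fun_eq_iff algebra_simps sum.distrib)

lemma commutator_add_right: "commutator N C (A + B) = commutator N C A + commutator N C B"
  by (simp add: commutator_def mmult_def fun_eq_iff algebra_simps sum.distrib)

lemma commutator_scale_left: "commutator N (mscale x A) C = mscale x (commutator N A C)"
  by (simp add: commutator_def mmult_def mscale_def fun_eq_iff algebra_simps sum_distrib_left)

lemma commutator_scale_right: "commutator N C (mscale x A) = mscale x (commutator N C A)"
  by (simp add: commutator_def mmult_def mscale_def fun_eq_iff algebra_simps sum_distrib_left)

lemmas commutator_bilinear =
  commutator_add_left commutator_add_right commutator_scale_left commutator_scale_right

lemma sum_matrix_apply: "(\<Sum>x\<in>S. f x) i j = (\<Sum>x\<in>S. (f x :: matrix) i j)"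
  by (induction S rule: infinite_finite_induct) auto

lemma lie_subalgebra_Lie:
  assumes "S \<subseteq> gl N"
  shows "lie_subalgebra N (Lie N S)"
proof -
  have "Lie N S \<subseteq> gl N"
    unfolding Lie_def using assms lie_subalgebra_gl by (rule hull_minimal)
  then show ?thesis
    unfolding lie_subalgebra_def Lie_def hull_def
    by (auto simp: lie_subalgebra_def intro!: matrix.subspace_Inter)
qed

lemma Lie_inc: "A \<in> S \<Longrightarrow> A \<in> Lie N S"
  unfolding Lie_def by (rule hull_inc)

lemma lie_subalgebra_sl: "lie_subalgebra N (sl N)"
proof -
  have "(\<Sum>i\<in>Z20 N. mmult N A B i i) = (\<Sum>i\<in>Z20 N. mmult N B A i i)" for A B
    unfolding mmult_def by (subst sum.swap) (simp add: mult.commute)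
  moreover have "commutator N A B \<in> gl N" if "A \<in> gl N" "B \<in> gl N" for A B
    using that lie_subalgebra_gl unfolding lie_subalgebra_def by blast
  ultimately have "commutator N A B \<in> sl N" if "A \<in> sl N" "B \<in> sl N" for A B
    using that by (auto simp: sl_def commutator_def sum_subtractf)
  moreover have "matrix.subspace (sl N)"
    by (auto simp: matrix.subspace_def sl_def gl_def mscale_def sum.distrib
        simp flip: sum_distrib_left)
  ultimately show ?thesis
    unfolding lie_subalgebra_def by (auto simp: sl_def)
qed

lemma H_in_sl: "k \<in> Z20 N \<Longrightarrow> H N r k \<in> sl N"
  using H_in_gl[of N r k] by (auto simp: sl_def H_def Z20_def)

text \<open>The traces cancel when the diagonal part \<open>\<Sum>\<^sub>i A\<^sub>i\<^sub>i E\<^sub>i\<^sub>i\<close> is rewritten as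
  \<open>\<Sum>\<^sub>i A\<^sub>i\<^sub>i (E\<^sub>i\<^sub>i - E\<^sub>p\<^sub>p)\<close>, and each difference is the commutator of \<open>E\<^sub>i\<^sub>p\<close> and \<open>E\<^sub>p\<^sub>i\<close>.\<close>

lemma sl_subset_if_unit_matrices:
  assumes L: "lie_subalgebra N L"
    and units: "\<And>a b. a \<in> Z20 N \<Longrightarrow> b \<in> Z20 N \<Longrightarrow> a \<noteq> b \<Longrightarrow> unit_matrix a b \<in> L"
  shows "sl N \<subseteq> L"
proof
  fix A assume A: "A \<in> sl N"
  have sub: "matrix.subspace L"
    using L by (simp add: lie_subalgebra_def)
  show "A \<in> L"
  proof (cases "Z20 N = {}")
    case True
    then have "A = 0"
      using A by (auto simp: sl_def gl_def fun_eq_iff)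
    then show ?thesis
      using sub by (simp add: matrix.subspace_0)
  next
    case False
    then obtain p where p: "p \<in> Z20 N"
      by blast
    define B where
      "B i j = (if i = j then unit_matrix i i - unit_matrix p p else unit_matrix i j)" for i j
    have B: "B i j \<in> L" if "i \<in> Z20 N" "j \<in> Z20 N" for i j
    proof -
      consider "i \<noteq> j" | "i = j" "i = p" | "i = j" "i \<noteq> p"
        by blast
      then show ?thesis
      proof cases
        case 1
        then show ?thesis
          using that units by (simp add: B_def)
      next
        case 2
        then show ?thesis
          using matrix.subspace_0[OF sub] by (simp add: B_def)
      next
        case 3
        then have "unit_matrix i p \<in> L" "unit_matrix p i \<in> L"
          using units that p by auto
        then have "commutator N (unit_matrix i p) (unit_matrix p i) \<in> L"
          using L by (auto simp: lie_subalgebra_def)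
        then show ?thesis
          using 3 p that by (simp add: B_def commutator_unit_matrix)
      qed
    qed
    have "A = (\<Sum>a\<in>Z20 N. \<Sum>b\<in>Z20 N. mscale (A a b) (B a b))"
    proof (intro ext)
      fix i j
      have A0: "A i j = 0" if "i \<notin> Z20 N \<or> j \<notin> Z20 N"
        using that A unfolding sl_def gl_def by blast
      have tr: "(\<Sum>a\<in>Z20 N. A a a) = 0"
        using A by (simp add: sl_def)
      have "(\<Sum>a\<in>Z20 N. \<Sum>b\<in>Z20 N. mscale (A a b) (B a b)) i j
          = (\<Sum>a\<in>Z20 N. \<Sum>b\<in>Z20 N. A a b * B a b i j)"
        by (simp add: sum_matrix_apply mscale_def)
      also have "\<dots> = (\<Sum>a\<in>Z20 N. \<Sum>b\<in>Z20 N.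
          (if b = j then if a = i then A i j else 0 else 0)
          - (if b = a then A a a * unit_matrix p p i j else 0))"
        by (intro sum.cong refl) (auto simp: B_def unit_matrix_def)
      also have "\<dots> = (\<Sum>a\<in>Z20 N. (if a = i then if j \<in> Z20 N then A i j else 0 else 0)
          - A a a * unit_matrix p p i j)"
        by (intro sum.cong refl) (auto simp: sum_subtractf)
      also have "\<dots> = (if i \<in> Z20 N then if j \<in> Z20 N then A i j else 0 else 0)
          - (\<Sum>a\<in>Z20 N. A a a) * unit_matrix p p i j"
        by (simp add: sum_subtractf sum_distrib_right)
      also have "\<dots> = A i j"
        using A0 tr by auto
      finally show "A i j = (\<Sum>a\<in>Z20 N. \<Sum>b\<in>Z20 N. mscale (A a b) (B a b)) i j"
        by simp
    qed
    moreover have "(\<Sum>a\<in>Z20 N. \<Sum>b\<in>Z20 N. mscale (A a b) (B a b)) \<in> L"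
      by (intro matrix.subspace_sum[OF sub] matrix.subspace_scale[OF sub] B)
    ultimately show ?thesis
      by simp
  qed
qed

section \<open>Symmetries of the coefficients\<close>

lemma normsq_minus [simp]: "normsq r (- k) = normsq r k"
  by (simp add: normsq_def)

lemma coef_minus_left: "coef r (- j) k = - coef r j k"
  by (simp add: coef_def perp_inner_def algebra_simps)

lemma coef_minus_right: "coef r j (- k) = - coef r j k"
  by (simp add: coef_def perp_inner_def algebra_simps)

lemma coef_nonzero:
  assumes "r \<noteq> 0" "snd j * fst k \<noteq> fst j * snd k" "normsq r j \<noteq> normsq r k"
  shows "coef r j k \<noteq> 0"
proof -
  have "real_of_int (snd j * fst k - fst j * snd k) \<noteq> 0"
    using assms(2) by (simp only: of_int_eq_0_iff eq_iff_diff_eq_0[symmetric] not_False_eq_True)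
  then show ?thesis
    using assms by (simp add: coef_def perp_inner_def del: of_int_diff of_int_mult)
qed

text \<open>Negating row and column indices exchanges \<open>H\<^sup>k\<close> and \<open>H\<^sup>-\<^sup>k\<close>. It therefore turns the commutator
  \<open>[H\<^sup>k, H\<^sup>-\<^sup>k]\<close> into its negative, which makes the diagonals in the span odd.\<close>

lemma H_uminus_indices: "H N r k (- l) (- j) = H N r (- k) l j"
proof -
  have "k - j = - l \<longleftrightarrow> j - k = l"
    by (metis minus_diff_eq minus_equation_iff)
  then show ?thesis
    by (simp add: H_def coef_minus_left coef_minus_right)
qed

lemma diag_space_odd:
  assumes "D \<in> diag_space N r"
  shows "D (- x) (- x) = - D x x"
proof -
  have swap: "mmult N (H N r k) (H N r l) (- x) (- x) = mmult N (H N r (- k)) (H N r (- l)) x x"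
    for k l x
    unfolding mmult_def
    by (rule sum.reindex_bij_witness[of _ uminus uminus])
      (auto simp flip: H_uminus_indices)
  have "matrix.subspace {A. \<forall>x. A (- x) (- x) = - A x x}"
    by (auto simp: matrix.subspace_def mscale_def)
  then have "diag_space N r \<subseteq> {A. \<forall>x. A (- x) (- x) = - A x x}"
    unfolding diag_space_def
    by (intro matrix.span_minimal) (auto simp: commutator_def swap simp del: uminus_Pair)
  then show ?thesis
    using assms by blast
qed

section \<open>Weight components of the generators\<close>

text \<open>Only closure of \<open>L\<close> under the Lie operations matters, so \<open>L\<close> is any Lie subalgebra that
  contains the generators.\<close>

locale distinct_diagonal =
  fixes N :: int and r :: real and L :: "matrix set" and D :: matrix
  assumes r_pos: "r > 0"
    and lie_L: "lie_subalgebra N L"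
    and H_in_L: "k \<in> Z20 N \<Longrightarrow> H N r k \<in> L"
    and D_in: "D \<in> diag_space N r"
    and D_distinct: "distinct_matrix N D"
begin

lemma subspace_L: "matrix.subspace L"
  and L_gl: "A \<in> L \<Longrightarrow> A \<in> gl N"
  and commutator_in_L: "A \<in> L \<Longrightarrow> B \<in> L \<Longrightarrow> commutator N A B \<in> L"
  using lie_L by (auto simp: lie_subalgebra_def)

lemma scale_in_L_iff:
  assumes "x \<noteq> 0"
  shows "mscale x A \<in> L \<longleftrightarrow> A \<in> L"
  using assms matrix.subspace_scale[OF subspace_L, of A x]
    matrix.subspace_scale[OF subspace_L, of "mscale x A" "inverse x"]
  by (auto simp: mscale_def mult.assoc[symmetric])

lemma D_in_L: "D \<in> L"
proof -
  have "diag_space N r \<subseteq> L"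
    unfolding diag_space_def
    by (intro matrix.span_minimal subspace_L) (auto intro!: commutator_in_L H_in_L simp del: uminus_Pair)
  then show ?thesis
    using D_in by blast
qed

lemma commutator_D:
  assumes "A \<in> L"
  shows "commutator N D A i j = (D i i - D j j) * A i j"
proof -
  have D0: "D i j = 0" if "i \<noteq> j \<or> i \<notin> Z20 N" for i j
    using that diag_space_diagonal[OF D_in] L_gl[OF D_in_L]
    unfolding diagonal_def gl_def by blast
  have "mmult N D A i j = (\<Sum>m\<in>Z20 N. if m = i then D i i * A i j else 0)"
    unfolding mmult_def by (intro sum.cong) (auto simp: D0)
  then have 1: "mmult N D A i j = D i i * A i j"
    by (simp add: D0)
  have "mmult N A D i j = (\<Sum>m\<in>Z20 N. if m = j then A i j * D j j else 0)"
    unfolding mmult_def by (intro sum.cong) (auto simp: D0)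
  then have 2: "mmult N A D i j = A i j * D j j"
    by (simp add: D0)
  show ?thesis
    by (simp add: commutator_def 1 2 algebra_simps)
qed

text \<open>The operator \<open>ad D\<close> multiplies the entry at \<open>(i, j)\<close> by \<open>D\<^sub>i - D\<^sub>j\<close>, and \<open>L\<close> is stable
  under every polynomial in it. The polynomial that vanishes at all the weights but \<open>t\<close>
  projects onto the weight space of \<open>t\<close>, up to a nonzero factor.\<close>

lemma weight_component_in_L:
  assumes A: "A \<in> L"
  shows "(\<lambda>i j. if D i i - D j j = t then A i j else 0) \<in> L"
proof -
  have poly: "(\<lambda>i j. (\<Prod>\<mu>\<in>M. D i i - D j j - \<mu>) * A i j) \<in> L" if "finite M" for M
    using that
  proof induction
    case empty
    then show ?case
      using A by simp
  next
    case (insert \<mu> M)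
    let ?B = "\<lambda>i j. (\<Prod>\<mu>\<in>M. D i i - D j j - \<mu>) * A i j"
    have "commutator N D ?B - mscale \<mu> ?B \<in> L"
      by (intro matrix.subspace_diff[OF subspace_L] matrix.subspace_scale[OF subspace_L]
          commutator_in_L D_in_L insert.IH)
    also have "commutator N D ?B - mscale \<mu> ?B
        = (\<lambda>i j. (\<Prod>\<mu>\<in>insert \<mu> M. D i i - D j j - \<mu>) * A i j)"
      using insert.hyps
      by (intro ext) (simp add: commutator_D[OF insert.IH] mscale_def left_diff_distrib mult.assoc)
    finally show ?case .
  qed
  define M where "M = (\<lambda>(i, j). D i i - D j j) ` (Z20 N \<times> Z20 N) - {t}"
  have fin: "finite M"
    by (simp add: M_def)
  define c where "c = (\<Prod>\<mu>\<in>M. t - \<mu>)"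
  have c: "c \<noteq> 0"
    using fin by (auto simp: c_def M_def)
  have "(\<Prod>\<mu>\<in>M. D i i - D j j - \<mu>) * A i j = c * (if D i i - D j j = t then A i j else 0)" for i j
  proof (cases "D i i - D j j = t \<or> A i j = 0")
    case True
    then show ?thesis
      by (auto simp: c_def)
  next
    case False
    then have "i \<in> Z20 N" "j \<in> Z20 N"
      using L_gl[OF A] unfolding gl_def by blast+
    then have "D i i - D j j \<in> M"
      using False by (auto simp: M_def)
    then have "(\<Prod>\<mu>\<in>M. D i i - D j j - \<mu>) = 0"
      using fin by auto
    then show ?thesis
      using False by simp
  qed
  then have "mscale c (\<lambda>i j. if D i i - D j j = t then A i j else 0) \<in> L"
    using poly[OF fin] by (simp add: mscale_def)
  then show ?thesis
    using c by (simp add: scale_in_L_iff)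
qed

text \<open>Because \<open>D\<close> is odd, \<open>D\<^sub>a - D\<^sub>b = D\<^sub>c - D\<^sub>d\<close> reads
  \<open>D\<^sub>a + D\<^sub>-\<^sub>b + D\<^sub>-\<^sub>c + D\<^sub>d = 0\<close>, a relation among four indices of sum zero.
  Distinctness leaves only the two solutions that the oddness of \<open>D\<close> forces.\<close>

lemma same_weight_cases:
  assumes "a \<in> Z20 N" "b \<in> Z20 N" "c \<in> Z20 N" "d \<in> Z20 N"
    and "a - b = c - d" "a \<noteq> b" "D a a - D b b = D c c - D d d"
  shows "c = a \<and> d = b \<or> c = - b \<and> d = - a"
proof (rule ccontr)
  assume neg: "\<not> ?thesis"
  have "a - c \<noteq> 0" "a + d \<noteq> 0"
    using neg assms(5) by (auto simp: algebra_simps eq_neg_iff_add_eq_0)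
  then have "(a, - b, - c, d) \<in> quads N"
    using assms by (auto simp: quads_def)
  moreover have "a + - b + - c + d = 0"
    using assms(5) by (simp add: algebra_simps)
  ultimately have "D a a + D (- b) (- b) + D (- c) (- c) + D d d \<noteq> 0"
    using D_distinct unfolding distinct_matrix_def by blast
  then show False
    using assms(7) by (simp add: diag_space_odd[OF D_in])
qed

text \<open>The part of \<open>H\<^sup>a\<^sup>-\<^sup>b\<close> that is supported on the position \<open>(a, b)\<close> and on its mirror image
  \<open>(-b, -a)\<close>.\<close>

definition twin :: "int \<times> int \<Rightarrow> int \<times> int \<Rightarrow> matrix" where
  "twin a b = mscale (coef r b (a - b)) (unit_matrix a b)
     + mscale (coef r (- a) (a - b)) (unit_matrix (- b) (- a))"

text \<open>This is the weight component of \<open>H\<^sup>a\<^sup>-\<^sup>b\<close> for the weight of \<open>E\<^sub>a\<^sub>b\<close>. For \<open>a + b = 0\<close> the two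
  positions coincide, and the twin would count the single entry twice.\<close>

lemma twin_in_L:
  assumes a: "a \<in> Z20 N" and b: "b \<in> Z20 N" and ab: "a - b \<in> Z20 N" "a + b \<noteq> 0"
  shows "twin a b \<in> L"
proof -
  have "a \<noteq> b"
    using ab by (auto simp: Z20_def)
  have "a \<noteq> - b"
    using ab by auto
  have "(\<lambda>i j. if D i i - D j j = D a a - D b b then H N r (a - b) i j else 0) = twin a b"
  proof (intro ext)
    fix i j
    have "D (- b) (- b) - D (- a) (- a) = D a a - D b b"
      by (simp add: diag_space_odd[OF D_in])
    moreover have "i = a \<and> j = b \<or> i = - b \<and> j = - a"
      if "D i i - D j j = D a a - D b b" "i \<in> Z20 N" "j \<in> Z20 N" "a - b + j = i"
      using same_weight_cases[of a b i j] that a b \<open>a \<noteq> b\<close> by force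
    ultimately show "(if D i i - D j j = D a a - D b b then H N r (a - b) i j else 0)
        = twin a b i j"
      using a b \<open>a \<noteq> - b\<close> by (auto simp: H_def twin_def mscale_def unit_matrix_def)
  qed
  then show ?thesis
    using weight_component_in_L[OF H_in_L[OF ab(1)], of "D a a - D b b"] by simp
qed

section \<open>Moving along edges\<close>

text \<open>The last three conditions say that both coefficients in \<open>twin a b\<close> are nonzero: a factor of
  \<open>c\<^sub>j\<^sub>,\<^sub>k\<close> vanishes exactly when \<open>j\<close> and \<open>k\<close> are parallel or have the same length.\<close>

definition edge :: "int \<times> int \<Rightarrow> int \<times> int \<Rightarrow> bool" where
  "edge a b \<longleftrightarrow> a \<in> Z20 N \<and> b \<in> Z20 N \<and> a - b \<in> Z20 N \<and> fst a * snd b \<noteq> snd a * fst b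
     \<and> normsq r (a - b) \<noteq> normsq r a \<and> normsq r (a - b) \<noteq> normsq r b"

lemma edge_sym: "edge a b \<Longrightarrow> edge b a"
  using normsq_minus[of r "a - b"] uminus_in_Z20_iff[of "a - b" N]
  by (auto simp: edge_def mult.commute simp del: normsq_minus uminus_in_Z20_iff)

lemma edgeD:
  assumes "edge a b"
  shows "a \<in> Z20 N" "b \<in> Z20 N" "a - b \<in> Z20 N" "a + b \<noteq> 0" "a \<noteq> b"
    "coef r b (a - b) \<noteq> 0" "coef r (- a) (a - b) \<noteq> 0" "twin a b \<in> L"
proof -
  show *: "a \<in> Z20 N" "b \<in> Z20 N" "a - b \<in> Z20 N"
    using assms by (auto simp: edge_def)
  show "a + b \<noteq> 0"
    using assms by (auto simp: edge_def add_eq_0_iff)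
  then show "twin a b \<in> L"
    using * by (intro twin_in_L)
  show "a \<noteq> b"
    using *(3) by (auto simp: Z20_def)
  show "coef r b (a - b) \<noteq> 0" "coef r (- a) (a - b) \<noteq> 0"
    using r_pos assms by (intro coef_nonzero; auto simp: edge_def algebra_simps)+
qed

text \<open>Including the case \<open>a = b\<close> makes this a preorder on the indices, because
  \<open>[E\<^sub>a\<^sub>b, E\<^sub>b\<^sub>c] = E\<^sub>a\<^sub>c\<close> for \<open>a \<noteq> c\<close>.\<close>

definition linked :: "int \<times> int \<Rightarrow> int \<times> int \<Rightarrow> bool" where
  "linked a b \<longleftrightarrow> a = b \<or> unit_matrix a b \<in> L"

lemma linked_trans:
  assumes "linked a b" "linked b c" "b \<in> Z20 N" "c \<in> Z20 N"
  shows "linked a c"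
proof (cases "a = b \<or> b = c \<or> a = c")
  case True
  then show ?thesis
    using assms by (auto simp: linked_def)
next
  case False
  then have "commutator N (unit_matrix a b) (unit_matrix b c) \<in> L"
    using assms by (auto simp: linked_def intro: commutator_in_L)
  then show ?thesis
    using False assms by (auto simp: commutator_unit_matrix linked_def)
qed

text \<open>In the bracket of \<open>E\<^sub>a\<^sub>c\<close> with \<open>twin c b\<close> the mirror term, which sits at row \<open>-b\<close> and column
  \<open>-c\<close>, contributes only if \<open>a = -c\<close>. Excluding that case leaves a nonzero multiple of \<open>E\<^sub>a\<^sub>b\<close>.\<close>

lemma linked_step_right:
  assumes ac: "linked a c" and "a \<noteq> c" "a + c \<noteq> 0" "c \<in> Z20 N" and cb: "edge c b"
  shows "linked a b"
proof (cases "a = b")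
  case False
  note e = edgeD[OF cb]
  have "c \<noteq> - b" "a \<noteq> - c"
    using e(4) assms(3) by auto
  moreover have "commutator N (unit_matrix a c) (twin c b) \<in> L"
    using ac assms e by (auto simp: linked_def intro: commutator_in_L)
  ultimately have "mscale (coef r b (c - b)) (unit_matrix a b) \<in> L"
    using False assms e by (simp add: twin_def commutator_bilinear commutator_unit_matrix)
  then show ?thesis
    using e by (simp add: scale_in_L_iff linked_def)
qed (simp add: linked_def)

lemma linked_step_left:
  assumes ac: "linked a c" and "a \<noteq> c" "a + c \<noteq> 0" "c \<in> Z20 N" and ba: "edge b a"
  shows "linked b c"
proof (cases "b = c")
  case False
  note e = edgeD[OF ba]
  have "a \<noteq> - b" "c \<noteq> - a" "- b \<noteq> a"
    using e(4) assms(3) by (auto simp: add_eq_0_iff)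
  moreover have "commutator N (twin b a) (unit_matrix a c) \<in> L"
    using ac assms e by (auto simp: linked_def intro: commutator_in_L)
  ultimately have "mscale (coef r a (b - a)) (unit_matrix b c) \<in> L"
    using False assms e by (auto simp: twin_def commutator_bilinear commutator_unit_matrix)
  then show ?thesis
    using e by (simp add: scale_in_L_iff linked_def)
qed (simp add: linked_def)

text \<open>Along \<open>a, b, c\<close> the main terms of the twins multiply to a multiple \<open>p\<close> of \<open>E\<^sub>a\<^sub>c\<close>. The mirror terms
  multiply in the opposite order, which gives a multiple \<open>- q\<close> of the mirror image of \<open>E\<^sub>a\<^sub>c\<close>. The
  assumption on the coefficients is that the vector \<open>(p, - q)\<close> is not parallel to the pair of
  coefficients of \<open>twin a c\<close>, so that the mirror term can be eliminated.\<close>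

lemma separation:
  assumes ab: "edge a b" and bc: "edge b c" and ac: "edge a c"
    and det: "coef r b (a - b) * coef r c (b - c) * coef r (- a) (a - c)
      + coef r (- a) (a - b) * coef r (- b) (b - c) * coef r c (a - c) \<noteq> 0"
  shows "linked a c"
proof -
  note e = edgeD[OF ab] edgeD[OF bc] edgeD[OF ac]
  have ne: "a \<noteq> - b" "b \<noteq> - a" "b \<noteq> - c" "c \<noteq> - b" "a \<noteq> - c" "c \<noteq> - a"
    using e(4,12,20) by (auto simp: add_eq_0_iff)
  let ?p = "coef r b (a - b) * coef r c (b - c)"
  let ?q = "coef r (- a) (a - b) * coef r (- b) (b - c)"
  let ?X = "commutator N (twin a b) (twin b c)"
  have X: "?X = mscale ?p (unit_matrix a c) - mscale ?q (unit_matrix (- c) (- a))"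
    using e ne by (simp add: twin_def commutator_bilinear commutator_unit_matrix)
      (simp add: mscale_def fun_eq_iff algebra_simps)
  have "mscale (coef r (- a) (a - c)) ?X + mscale ?q (twin a c) \<in> L"
    by (intro matrix.subspace_add[OF subspace_L] matrix.subspace_scale[OF subspace_L]
        commutator_in_L e)
  also have "mscale (coef r (- a) (a - c)) ?X + mscale ?q (twin a c)
      = mscale (?p * coef r (- a) (a - c) + ?q * coef r c (a - c)) (unit_matrix a c)"
    unfolding X by (simp add: twin_def mscale_def fun_eq_iff algebra_simps)
  finally show ?thesis
    using det by (simp add: scale_in_L_iff linked_def)
qed

section \<open>Connecting all indices\<close>

lemma edge_axes:
  assumes "N \<ge> 2" "\<bar>s\<bar> = 1" "\<bar>t\<bar> = 1"
  shows "edge (s, 0) (0, t)" "edge (0, t) (s, 0)"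
proof -
  show "edge (s, 0) (0, t)"
    using assms r_pos by (auto simp: edge_def Pair_in_Z20_iff normsq_def abs_if split: if_splits)
  then show "edge (0, t) (s, 0)"
    by (rule edge_sym)
qed

text \<open>The second vector \<open>h'\<close> is the companion that \<open>h\<close> needs when it is moved to \<open>v\<close>: a step from
  the pair \<open>h, h'\<close> is possible only if \<open>h'\<close> is neither \<open>h\<close> nor \<open>- h\<close>.\<close>

lemma edge_to_axis:
  assumes N: "N \<ge> 2" and v: "v \<in> Z20 N"
  obtains h h' where "edge v h" "h \<in> {(1, 0), (-1, 0), (0, 1)}" "h' \<in> {(1, 0), (0, 1)}"
    "h \<noteq> h'" "h + h' \<noteq> 0"
proof (cases "snd v = 0")
  case True
  then have "edge v (0, 1)"
    using assms r_pos by (cases v) (auto simp: edge_def Pair_in_Z20_iff normsq_def power2_eq_square)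
  then show ?thesis
    by (intro that[of "(0, 1)" "(1, 0)"]) (auto simp: zero_prod_def)
next
  case False
  obtain x y where xy: "v = (x, y)"
    by (cases v)
  \<comment> \<open>The sign is chosen such that \<open>v - (s, 0)\<close> stays in the box and has a nonzero first
    coordinate; it is then longer than \<open>(s, 0)\<close>, whatever the value of \<open>r\<close>.\<close>
  define s :: int where "s = (if x = 1 \<or> x = - N then -1 else 1)"
  have s: "\<bar>s\<bar> = 1" "\<bar>x - s\<bar> \<ge> 1" "\<bar>x - s\<bar> \<le> N"
    using N v by (auto simp: s_def xy Pair_in_Z20_iff)
  have "(x - s)\<^sup>2 \<ge> 1"
    using s(2) by (metis abs_le_square_iff abs_one one_power2)
  then have "(real_of_int (x - s))\<^sup>2 \<ge> 1"
    by (metis of_int_1_le_iff of_int_power)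
  moreover have "r\<^sup>2 * (real_of_int y)\<^sup>2 > 0"
    using False r_pos xy by simp
  ultimately have "(real_of_int (x - s))\<^sup>2 + r\<^sup>2 * (real_of_int y)\<^sup>2 \<noteq> 1"
    by linarith
  moreover have "(real_of_int s)\<^sup>2 = 1"
    by (simp add: s_def)
  moreover have "(x - s)\<^sup>2 \<noteq> x\<^sup>2"
  proof
    assume "(x - s)\<^sup>2 = x\<^sup>2"
    then have "s = 2 * x"
      using s(1) by (auto simp: power2_eq_iff)
    then show False
      using s(1) by presburger
  qed
  then have "(real_of_int (x - s))\<^sup>2 \<noteq> (real_of_int x)\<^sup>2"
    by (metis of_int_eq_iff of_int_power)
  ultimately have "edge v (s, 0)"
    using v s False N unfolding edge_def normsq_def xy
    by (auto simp: Pair_in_Z20_iff simp del: of_int_diff)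
  then show ?thesis
    by (intro that[of "(s, 0)" "(0, 1)"]) (auto simp: s_def zero_prod_def)
qed

lemma edge_off_axis:
  assumes "N \<ge> 2"
  shows "edge (2, -1) (1, 0)" "edge (2, -1) (0, 1)"
proof -
  have "3 * r\<^sup>2 + 4 \<noteq> 0"
    using zero_le_power2[of r] by linarith
  then show "edge (2, -1) (1, 0)" "edge (2, -1) (0, 1)"
    using assms r_pos by (auto simp: edge_def Pair_in_Z20_iff normsq_def)
qed

text \<open>For \<open>a = (x, y)\<close> and the axis vectors \<open>b = (1, 0)\<close>, \<open>c = (0, 1)\<close>, and up to factors without
  influence on vanishing, the determinant is \<open>A + r\<^sup>2 B\<close> with \<open>A = x\<^sup>2 (x - y) + 2 x y - x\<close> and
  \<open>B = y\<^sup>2 (x - y) - 2 x y + y\<close>. At \<open>(2, -1)\<close> both are \<open>6\<close>, so that no value of \<open>r\<close> is exceptional.\<close>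

lemma separated_link:
  assumes "N \<ge> 2"
  shows "linked (2, -1) (0, 1)"
proof (rule separation[of _ "(1, 0)"])
  have r2: "r\<^sup>2 > 0"
    using r_pos by simp
  show "edge (2, -1) (1, 0)" "edge (1, 0) (0, 1)" "edge (2, -1) (0, 1)"
    using assms edge_off_axis edge_axes by auto
  have nz: "r \<noteq> 0" "1 + r\<^sup>2 \<noteq> 0" "4 + r\<^sup>2 \<noteq> 0" "4 + 4 * r\<^sup>2 \<noteq> 0"
    using r_pos r2 by linarith+
  have c: "coef r (1, 0) ((2, -1) - (1, 0)) = - (r * r\<^sup>2 / (1 + r\<^sup>2))"
    "coef r (0, 1) ((1, 0) - (0, 1)) = - (r / (r\<^sup>2 * (1 + r\<^sup>2)))"
    "coef r (- (2, -1)) ((2, -1) - (0, 1)) = 3 * r * r\<^sup>2 / (2 * (1 + r\<^sup>2) * (4 + r\<^sup>2))"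
    "coef r (- (2, -1)) ((2, -1) - (1, 0)) = - (3 * r / ((1 + r\<^sup>2) * (4 + r\<^sup>2)))"
    "coef r (- (1, 0)) ((1, 0) - (0, 1)) = r * r\<^sup>2 / (1 + r\<^sup>2)"
    "coef r (0, 1) ((2, -1) - (0, 1)) = - (r * (4 + 3 * r\<^sup>2) / (2 * r\<^sup>2 * (1 + r\<^sup>2)))"
    using nz by (simp_all add: coef_def perp_inner_def normsq_def divide_simps)
      (simp_all add: algebra_simps power2_eq_square)
  show "coef r (1, 0) ((2, -1) - (1, 0)) * coef r (0, 1) ((1, 0) - (0, 1))
      * coef r (- (2, -1)) ((2, -1) - (0, 1))
    + coef r (- (2, -1)) ((2, -1) - (1, 0)) * coef r (- (1, 0)) ((1, 0) - (0, 1))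
      * coef r (0, 1) ((2, -1) - (0, 1)) \<noteq> 0"
    unfolding c using r_pos r2
    by (intro less_imp_neq[symmetric] add_pos_pos) (simp_all add: add_pos_pos)
qed

text \<open>The four axis vectors form a cycle of edges, but the steps along this cycle alone do not suffice:
  a pair of adjacent axis vectors can only step to a pair of opposite ones, and from there no step
  is possible. The vertex \<open>(2, -1)\<close> gives the room that is missing: while one member of the pair
  waits there, the other visits all four axis vectors.\<close>

lemma axes_linked:
  assumes N: "N \<ge> 2" and "h \<in> {(1, 0), (-1, 0), (0, 1), (0, -1)}"
    and "h' \<in> {(1, 0), (-1, 0), (0, 1), (0, -1)}"
  shows "linked h h'"
proof -
  have Z: "(1, 0) \<in> Z20 N" "(-1, 0) \<in> Z20 N" "(0, 1) \<in> Z20 N" "(0, -1) \<in> Z20 N"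
    using N by (auto simp: Pair_in_Z20_iff)
  have axes: "edge (1, 0) (0, 1)" "edge (0, 1) (1, 0)" "edge (0, 1) (-1, 0)" "edge (-1, 0) (0, 1)"
    "edge (-1, 0) (0, -1)" "edge (0, -1) (1, 0)"
    using edge_axes[OF N] by auto
  have a: "edge (1, 0) (2, -1)" "edge (0, 1) (2, -1)"
    using edge_off_axis[OF N] by (auto intro: edge_sym)
  have 1: "linked (2, -1) (0, 1)"
    by (rule separated_link[OF N])
  have 2: "linked (2, -1) (1, 0)" "linked (2, -1) (-1, 0)"
    using linked_step_right[OF 1] axes Z by (auto simp: zero_prod_def)
  have 3: "linked (2, -1) (0, -1)"
    using linked_step_right[OF 2(2)] axes Z by (auto simp: zero_prod_def)
  have 4: "linked (1, 0) (0, 1)" "linked (1, 0) (-1, 0)" "linked (1, 0) (0, -1)"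
      "linked (0, 1) (1, 0)"
    using linked_step_left[OF 1] linked_step_left[OF 2(1)] linked_step_left[OF 2(2)]
      linked_step_left[OF 3] a Z by (auto simp: zero_prod_def)
  have "linked (0, -1) (0, 1)" "linked (-1, 0) (1, 0)"
    using linked_step_left[OF 4(1)] linked_step_left[OF 4(4)] axes Z by (auto simp: zero_prod_def)
  then have "linked k (1, 0) \<and> linked (1, 0) k \<and> k \<in> Z20 N"
    if "k \<in> {(1, 0), (-1, 0), (0, 1), (0, -1)}" for k
    using that 4 Z linked_trans[of "(0, -1)" "(0, 1)" "(1, 0)"] by (auto simp: linked_def)
  then show ?thesis
    using assms linked_trans[of h "(1, 0)" h'] by blast
qed

lemma all_linked:
  assumes N: "N \<ge> 2" and u: "u \<in> Z20 N" and v: "v \<in> Z20 N"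
  shows "linked u v"
proof -
  have Z: "(1, 0) \<in> Z20 N" "(0, 1) \<in> Z20 N"
    using N by (auto simp: Pair_in_Z20_iff)
  have "linked w (1, 0) \<and> linked (1, 0) w" if w: "w \<in> Z20 N" for w
  proof -
    obtain h h' where h: "edge w h" "h \<in> {(1, 0), (-1, 0), (0, 1)}" "h' \<in> {(1, 0), (0, 1)}"
      "h \<noteq> h'" "h + h' \<noteq> 0"
      using edge_to_axis[OF N w] .
    have Zh: "h' \<in> Z20 N" "h \<in> Z20 N"
      using h Z edgeD[OF h(1)] by auto
    have "linked h h'" "linked h' h"
      using axes_linked[OF N] h by auto
    then have "linked w h'" "linked h' w"
      using linked_step_left[of h h' w] linked_step_right[of h' h w] h Zh
        edge_sym[OF h(1)] by (auto simp: add.commute)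
    moreover have "linked h' (1, 0)" "linked (1, 0) h'"
      using axes_linked[OF N] h by auto
    ultimately show ?thesis
      using linked_trans Zh Z w by blast
  qed
  then show ?thesis
    using linked_trans u v Z by blast
qed

lemma sl_subset_L:
  assumes "N \<ge> 2"
  shows "sl N \<subseteq> L"
  using all_linked[OF assms] by (intro sl_subset_if_unit_matrices[OF lie_L]) (auto simp: linked_def)

end

theorem corollary4p9:
  fixes N :: int and r :: real
  assumes "N \<ge> 392" and "r > 0"
    and "\<exists>D \<in> diag_space N r. distinct_matrix N D"
  shows "Lie N (H N r ` Z20 N) = sl N"
proof
  show "Lie N (H N r ` Z20 N) \<subseteq> sl N"
    unfolding Lie_def by (intro hull_minimal lie_subalgebra_sl) (auto intro: H_in_sl)
  obtain D where "D \<in> diag_space N r" "distinct_matrix N D"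
    using assms(3) by blast
  then interpret distinct_diagonal N r "Lie N (H N r ` Z20 N)" D
    using assms(2) H_in_gl
    by unfold_locales (auto intro!: lie_subalgebra_Lie simp: Lie_def[symmetric] intro: Lie_inc)
  show "sl N \<subseteq> Lie N (H N r ` Z20 N)"
    using assms(1) by (intro sl_subset_L) simp
qed

end
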